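(* Let $m\ge1$ be an integer and let $x_0<x_1<\cdots<x_m$ be real numbers with $x_m-x_0<\frac{2\pi h}{\ln(1+h)}$ and $(x_j-x_0)/h\in\mathbb{N}$ for $j=1,2,\ldots,m$. Then for every function $f:\mathbb{R}\to\mathbb{C}$, $$[x_0,\ldots,x_m;h]_ef=\frac{1}{A_h^{m-1}}\int_{x_0}^{x_m}e_h^{-i(m-1)y}\,E_{0,m}(y;h)\,(M_mf)(y-(m-1)h)\,d_hy,$$ where $$A_h^{k}=\begin{cases}1,&k=0,\\ \left(e_h^{ih}/h\right)^k\left(1-e_h^{-ih}\right)\left(1-e_h^{-2ih}\right)\cdots\left(1-e_h^{-kih}\right),&k\ne0.\end{cases}$$
   Context: Fix a real number $h\neq0$, $h>-1$. For real $x$ put $e_h^{ix}=(1+h)^{ix/h}=\exp\left(ix\frac{\ln(1+h)}{h}\right)$. The $h$-derivative is $\Delta_hf(x)=\frac{f(x+h)-f(x)}{h}$, and $I$ is the identity operator. $h$-integral: if $b-a\in h\mathbb{Z}$, $\int_a^bf(x)\,d_hx$ equals $h\left(f(a)+f(a+h)+\cdots+f(b-h)\right)$ if $a<b$, $0$ if $a=b$, and $-h\left(f(b)+f(b+h)+\cdots+f(a-h)\right)$ if $a>b$. Difference operator: $M_0=I$ and $M_m=\prod_{j=0}^{m-1}\left(\Delta_h-\frac{e_h^{ijh}-1}{h}I\right)$ for $m\ge1$. $h$-exponential divided difference: for nodes $x_0<\cdots<x_m$ with $x_m-x_0<\frac{2\pi h}{\ln(1+h)}$, $[x_k;h]_ef=f(x_k)$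 and $[x_0,\ldots,x_m;h]_ef=\frac{[x_1,\ldots,x_m;h]_ef-[x_0,\ldots,x_{m-1};h]_ef}{e_h^{ix_m}-e_h^{ix_0}}$ for $m\ge1$. $h$-truncated power: for $m\ge 1$, $\left(e_h^{iy}-e_h^{ix}\right)_+^{m-1}=\prod_{l=0}^{m-2}\left(e_h^{iy}-e_h^{i(x-lh)}\right)$ if $y>x$ (empty product $1$ for $m=1$), and $0$ if $y\le x$. For $m\ge1$, $E_{0,m}(x;h)=[x_0,\ldots,x_m;h]_e\left(e_h^{iy}-e_h^{ix}\right)_+^{m-1}$, the divided difference being taken with respect to $y$. *)

theory Defs
  imports Complex_Main
begin

text \<open>
  Throughout, \<open>h\<close> is a real step with \<open>h \<noteq> 0\<close> and \<open>h > -1\<close>;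
  these conditions are hypotheses of the results, not part of the definitions.
\<close>

text \<open>The \<open>h\<close>-exponential: \<open>hcexp h x\<close> stands for \<open>e\<^sub>h\<close> to the power \<open>i x\<close>.\<close>
definition hcexp :: "real \<Rightarrow> real \<Rightarrow> complex" where
  "hcexp h x = exp (\<i> * of_real (x * (ln (1 + h) / h)))"

definition hdelta :: "real \<Rightarrow> (real \<Rightarrow> complex) \<Rightarrow> (real \<Rightarrow> complex)" where
  "hdelta h f = (\<lambda>x. (f (x + h) - f x) / of_real h)"

text \<open>
  For \<open>b - a \<in> h\<int>\<close> and \<open>a < b\<close> the sum runs over \<open>a, a + h, \<dots>, b - h\<close>; the floor is then
  exact. The prescription \<open>a + h, \<dots>, b - h\<close> for \<open>a < b\<close> only makes sense for \<open>h > 0\<close>;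
  no meaning is attached to the value for \<open>h < 0\<close> or \<open>b - a \<notin> h\<int>\<close>.
\<close>
definition hintegral :: "real \<Rightarrow> real \<Rightarrow> real \<Rightarrow> (real \<Rightarrow> complex) \<Rightarrow> complex" where
  "hintegral h a b f =
     (if a < b then of_real h * (\<Sum>k<nat \<lfloor>(b - a) / h\<rfloor>. f (a + real k * h))
      else if a = b then 0
      else - of_real h * (\<Sum>k<nat \<lfloor>(a - b) / h\<rfloor>. f (b + real k * h)))"

text \<open>
  Operator product of the factors with indices \<open>j = 0, \<dots>, m - 1\<close>; the factors are polynomials in
  \<open>hdelta h\<close> and commute, so their order is irrelevant.
\<close>
primrec hM :: "real \<Rightarrow> nat \<Rightarrow> (real \<Rightarrow> complex) \<Rightarrow> (real \<Rightarrow> complex)" where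
  "hM h 0 = id"
| "hM h (Suc j) =
     (\<lambda>f x. hdelta h f x - (hcexp h (real j * h) - 1) / of_real h * f x) \<circ> hM h j"

text \<open>
  \<open>hdd h x f k n\<close> is the \<open>h\<close>-exponential divided difference of \<open>f\<close> at the \<open>n + 1\<close> nodes
  \<open>x k, \<dots>, x (k + n)\<close>. It is meaningful for increasing nodes of total width less than
  \<open>2 \<pi> h / ln (1 + h)\<close>, when the denominators do not vanish.
\<close>
fun hdd :: "real \<Rightarrow> (nat \<Rightarrow> real) \<Rightarrow> (real \<Rightarrow> complex) \<Rightarrow> nat \<Rightarrow> nat \<Rightarrow> complex" where
  "hdd h x f k 0 = f (x k)"
| "hdd h x f k (Suc n) =
     (hdd h x f (Suc k) n - hdd h x f k n) / (hcexp h (x (k + Suc n)) - hcexp h (x k))"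

text \<open>
  \<open>htrunc h n y t\<close> is the \<open>h\<close>-truncated power with exponent \<open>n\<close>; with \<open>n = m - 1\<close> the
  product runs over \<open>l = 0, \<dots>, m - 2\<close>.
\<close>
definition htrunc :: "real \<Rightarrow> nat \<Rightarrow> real \<Rightarrow> real \<Rightarrow> complex" where
  "htrunc h n y t =
     (if y > t then (\<Prod>l<n. hcexp h y - hcexp h (t - real l * h)) else 0)"

text \<open>The function \<open>E\<^sub>0\<^sub>,\<^sub>m\<close> for the nodes \<open>x 0, \<dots>, x m\<close> (\<open>m \<ge> 1\<close>), evaluated at \<open>t\<close>.\<close>
definition hE0 :: "real \<Rightarrow> (nat \<Rightarrow> real) \<Rightarrow> nat \<Rightarrow> real \<Rightarrow> complex" where
  "hE0 h x m t = hdd h x (\<lambda>y. htrunc h (m - 1) y t) 0 m"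

text \<open>The upper index \<open>k\<close> of the constant is a label, not a power.\<close>
definition hA :: "real \<Rightarrow> nat \<Rightarrow> complex" where
  "hA h k = (if k = 0 then 1
     else (hcexp h h / of_real h) ^ k * (\<Prod>j=1..k. 1 - hcexp h (- real j * h)))"

end

theory Submission
  imports Defs "HOL-Computational_Algebra.Polynomial"
begin

text \<open>
  This is the Peano kernel theorem for divided differences in the variable \<open>w = hcexp h y\<close>, on a
  grid of step \<open>h\<close>. Put \<open>q = hcexp h h\<close> and let \<open>S\<close> be the shift by \<open>h\<close>. Since \<open>S\<close> multiplies
  \<open>w^n\<close> by \<open>q^n\<close>, the operator \<open>hM h m\<close>, which is the product of the \<open>(S - q^j) / h\<close> for \<open>j < m\<close>,
  kills the powers \<open>w^n\<close> with \<open>n < m\<close>; so does the divided difference with \<open>m + 1\<close> nodes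
  (\<open>hdd_hcexp_power_eq_0\<close>). Conversely, a function that \<open>hM h m\<close> kills on a stretch of the grid is
  a polynomial of degree less than \<open>m\<close> in \<open>w\<close> there (\<open>hM_kernel\<close>).

  The truncated power is a fundamental solution of \<open>hM h m\<close>. The factors in its product are chosen
  so that the polynomial also vanishes at the \<open>m - 1\<close> grid points up to \<open>t\<close>, so that it is zero
  and polynomial at once there; hence the operator maps it to a multiple of a unit impulse
  at the grid point \<open>t - (m - 1) h\<close>, and \<open>hA h (m - 1)\<close> normalises that multiple
  (\<open>hM_htrunc_grid\<close>). Superposing truncated powers with the weights \<open>hM h m f\<close> gives a function
  \<open>g\<close> with \<open>hM h m g = hM h m f\<close> on the grid from
  \<open>x 0 - (m - 1) h\<close> to \<open>x m - m h\<close>. Then \<open>f - g\<close> is a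
  polynomial of degree less than \<open>m\<close> in \<open>w\<close> on all the nodes, so \<open>f\<close> and \<open>g\<close> have the same divided
  difference; that of \<open>g\<close>, taken termwise, is the integral.

  The bound on the width of the nodes enters twice: it makes \<open>hcexp h\<close> injective on the nodes, and,
  because the \<open>m + 1\<close> nodes on the grid span at least \<open>m h\<close>, it keeps \<open>q, \<dots>, q^m\<close> away from \<open>1\<close>,
  which makes \<open>w^j\<close> for \<open>j < m\<close> exhaust the kernel of \<open>hM h m\<close> and gives \<open>hA h (m - 1) \<noteq> 0\<close>.
\<close>

section \<open>The exponential\<close>

lemma hcexp_0 [simp]: "hcexp h 0 = 1"
  by (simp add: hcexp_def)

lemma hcexp_nonzero [simp]: "hcexp h y \<noteq> 0"
  by (simp add: hcexp_def)

lemma hcexp_add: "hcexp h (y + z) = hcexp h y * hcexp h z"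
  by (simp add: hcexp_def exp_add [symmetric] algebra_simps add_divide_distrib)

lemma hcexp_minus: "hcexp h (- y) = inverse (hcexp h y)"
  by (simp add: hcexp_def exp_minus [symmetric])

lemma hcexp_of_nat_mult: "hcexp h (real n * y) = hcexp h y ^ n"
  by (induction n) (simp_all add: hcexp_add algebra_simps)

lemma hcexp_neq_1:
  assumes "0 < y * (ln (1 + h) / h)" and "y * (ln (1 + h) / h) < 2 * pi"
  shows "hcexp h y \<noteq> 1"
proof
  define \<phi> where "\<phi> = y * (ln (1 + h) / h)"
  assume "hcexp h y = 1"
  then have "cis \<phi> = 1"
    by (simp add: hcexp_def \<phi>_def cis_conv_exp)
  then have "cos \<phi> = 1"
    by (metis cis.simps(1) one_complex.simps(1))
  then obtain n :: nat where n: "\<phi> = real n * 2 * pi \<or> \<phi> = - (real n * 2 * pi)"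
    using cos_one_2pi by auto
  have \<phi>: "0 < \<phi>" "\<phi> < 2 * pi"
    using assms by (simp_all add: \<phi>_def)
  show False
  proof (cases n)
    case 0
    with n \<phi> show False by simp
  next
    case (Suc k)
    then have "real n * 2 * pi \<ge> 2 * pi"
      using pi_gt_zero by (simp add: algebra_simps)
    with n \<phi> show False by auto
  qed
qed

lemma hcexp_neq:
  assumes "0 < (z - y) * (ln (1 + h) / h)" and "(z - y) * (ln (1 + h) / h) < 2 * pi"
  shows "hcexp h z \<noteq> hcexp h y"
  using hcexp_neq_1 [OF assms] hcexp_add [of h y "z - y"] by auto

section \<open>Divided differences\<close>

lemma hdd_cong:
  assumes "\<And>i. k \<le> i \<Longrightarrow> i \<le> k + n \<Longrightarrow> f (x i) = g (x i)"
  shows "hdd h x f k n = hdd h x g k n"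
  using assms by (induction n arbitrary: k) simp_all

lemma hdd_sum:
  "hdd h x (\<lambda>y. \<Sum>i\<in>A. c i * g i y) k n = (\<Sum>i\<in>A. c i * hdd h x (g i) k n)"
proof (induction n arbitrary: k)
  case (Suc n)
  show ?case
    unfolding hdd.simps Suc.IH
    by (simp add: sum_subtractf sum_divide_distrib diff_divide_distrib right_diff_distrib)
qed simp

lemma hdd_diff:
  "hdd h x (\<lambda>y. f y - g y) k n = hdd h x f k n - hdd h x g k n"
  by (induction n arbitrary: k) (simp_all add: diff_divide_distrib)

text \<open>
  This is the Leibniz rule for the product with \<open>w\<close> itself, whose divided differences of order two
  and more vanish; it drives the induction on the degree below.
\<close>
lemma hdd_hcexp_mult:
  assumes "\<And>i j. k \<le> i \<Longrightarrow> i < j \<Longrightarrow> j \<le> k + Suc n \<Longrightarrow> hcexp h (x j) \<noteq> hcexp h (x i)"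
  shows "hdd h x (\<lambda>y. hcexp h y * g y) k (Suc n) =
    hcexp h (x k) * hdd h x g k (Suc n) + hdd h x g (Suc k) n"
  using assms
proof (induction n arbitrary: k)
  case 0
  then have "hcexp h (x (Suc k)) \<noteq> hcexp h (x k)"
    by simp
  then show ?case
    by (simp add: field_simps)
next
  case (Suc n)
  define W where "W i = hcexp h (x i)" for i
  define G where "G j l = hdd h x g j l" for j l
  have ne: "W (k + Suc (Suc n)) \<noteq> W k" "W (k + Suc (Suc n)) \<noteq> W (Suc k)"
    using Suc.prems by (auto simp: W_def)
  have G1: "G (Suc k) (Suc n) * (W (k + Suc (Suc n)) - W (Suc k)) = G (Suc (Suc k)) n - G (Suc k) n"
    using ne by (simp add: G_def W_def)
  have G2: "G k (Suc (Suc n)) * (W (k + Suc (Suc n)) - W k) = G (Suc k) (Suc n) - G k (Suc n)"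
    using ne by (simp add: G_def W_def del: hdd.simps) (simp add: hdd.simps(2))
  have IH1: "hdd h x (\<lambda>y. hcexp h y * g y) k (Suc n) = W k * G k (Suc n) + G (Suc k) n"
    unfolding W_def G_def by (rule Suc.IH) (use Suc.prems in auto)
  have IH2: "hdd h x (\<lambda>y. hcexp h y * g y) (Suc k) (Suc n) =
      W (Suc k) * G (Suc k) (Suc n) + G (Suc (Suc k)) n"
    unfolding W_def G_def by (rule Suc.IH) (use Suc.prems in auto)
  have "hdd h x (\<lambda>y. hcexp h y * g y) k (Suc (Suc n)) * (W (k + Suc (Suc n)) - W k) =
      W (Suc k) * G (Suc k) (Suc n) + G (Suc (Suc k)) n - (W k * G k (Suc n) + G (Suc k) n)"
    using ne IH1 IH2 by (subst hdd.simps(2)) (simp add: W_def del: hdd.simps)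
  also have "\<dots> = W k * (G k (Suc (Suc n)) * (W (k + Suc (Suc n)) - W k))
      + G (Suc k) (Suc n) * (W (k + Suc (Suc n)) - W k)"
    using G1 unfolding G2 by (simp add: algebra_simps)
  also have "\<dots> =
      (W k * G k (Suc (Suc n)) + G (Suc k) (Suc n)) * (W (k + Suc (Suc n)) - W k)"
    by (simp only: distrib_right mult.assoc)
  finally have "hdd h x (\<lambda>y. hcexp h y * g y) k (Suc (Suc n)) =
      W k * G k (Suc (Suc n)) + G (Suc k) (Suc n)"
    using ne(1) by (simp only: mult_right_cancel right_minus_eq not_False_eq_True)
  then show ?case
    by (simp only: W_def G_def)
qed

lemma hdd_hcexp_power_eq_0:
  assumes "\<And>i j. k \<le> i \<Longrightarrow> i < j \<Longrightarrow> j \<le> k + n \<Longrightarrow> hcexp h (x j) \<noteq> hcexp h (x i)"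
    and "d < n"
  shows "hdd h x (\<lambda>y. hcexp h y ^ d) k n = 0"
  using assms
proof (induction d arbitrary: k n)
  case 0
  have "hdd h x (\<lambda>y. 1) k (Suc n) = 0" for n
  proof (induction n arbitrary: k)
    case (Suc n)
    show ?case
      by (subst hdd.simps(2)) (simp only: Suc diff_self div_0)
  qed simp
  with 0 show ?case
    by (cases n) (auto simp del: hdd.simps)
next
  case (Suc d)
  then obtain l where n: "n = Suc l"
    by (cases n) auto
  have "hdd h x (\<lambda>y. hcexp h y * hcexp h y ^ d) k (Suc l) = hcexp h (x k) * 0 + 0"
  proof (subst hdd_hcexp_mult)
    show "hcexp h (x k) * hdd h x (\<lambda>y. hcexp h y ^ d) k (Suc l) +
        hdd h x (\<lambda>y. hcexp h y ^ d) (Suc k) l = hcexp h (x k) * 0 + 0"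
      using Suc.prems unfolding n by (subst (1 2) Suc.IH) auto
  qed (use Suc.prems n in auto)
  then show ?case
    by (simp add: n del: hdd.simps)
qed

section \<open>The difference operator\<close>

lemma hM_Suc_shift:
  assumes "h \<noteq> 0"
  shows "hM h (Suc m) f s = (hM h m f (s + h) - hcexp h h ^ m * hM h m f s) / of_real h"
  using assms
  by (simp only: hM.simps comp_def hdelta_def hcexp_of_nat_mult) (simp add: field_simps)

declare hM.simps(2) [simp del]

lemma hM_cong:
  assumes "h \<noteq> 0" and "\<And>i. i \<le> m \<Longrightarrow> f (s + real i * h) = g (s + real i * h)"
  shows "hM h m f s = hM h m g s"
  using assms(2)
proof (induction m arbitrary: s)
  case 0
  from 0 [of 0] show ?case by simp
next
  case (Suc m)
  have "hM h m f s = hM h m g s"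
    using Suc.prems by (intro Suc.IH) auto
  moreover have "hM h m f (s + h) = hM h m g (s + h)"
  proof (rule Suc.IH)
    fix i assume "i \<le> m"
    then show "f (s + h + real i * h) = g (s + h + real i * h)"
      using Suc.prems [of "Suc i"] by (simp add: algebra_simps)
  qed
  ultimately show ?case
    by (simp add: hM_Suc_shift [OF assms(1)])
qed

lemma hM_sum:
  assumes "h \<noteq> 0"
  shows "hM h m (\<lambda>y. \<Sum>i\<in>A. c i * g i y) s = (\<Sum>i\<in>A. c i * hM h m (g i) s)"
proof (induction m arbitrary: s)
  case (Suc m)
  show ?case
    unfolding hM_Suc_shift [OF assms] Suc.IH
    by (simp add: sum_distrib_left sum_subtractf sum_divide_distrib diff_divide_distrib
        algebra_simps)
qed simp

lemma hM_diff:
  assumes "h \<noteq> 0"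
  shows "hM h m (\<lambda>y. f y - g y) s = hM h m f s - hM h m g s"
proof (induction m arbitrary: s)
  case (Suc m)
  show ?case
    unfolding hM_Suc_shift [OF assms] Suc.IH
    by (simp add: diff_divide_distrib add_divide_distrib algebra_simps)
qed simp

lemma hM_cmult:
  assumes "h \<noteq> 0"
  shows "hM h m (\<lambda>y. c * g y) s = c * hM h m g s"
  using hM_sum [OF assms, where A = "{0::nat}" and c = "\<lambda>_. c" and g = "\<lambda>_. g"] by simp

text \<open>Powers of \<open>w\<close> are eigenfunctions, because the shift is diagonal on them.\<close>
lemma hM_hcexp_power:
  assumes "h \<noteq> 0"
  shows "hM h m (\<lambda>y. hcexp h y ^ n) s =
    (\<Prod>j<m. (hcexp h h ^ n - hcexp h h ^ j) / of_real h) * hcexp h s ^ n"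
proof (induction m arbitrary: s)
  case (Suc m)
  show ?case
    unfolding hM_Suc_shift [OF assms] Suc.IH
    by (simp add: hcexp_add power_mult_distrib diff_divide_distrib algebra_simps)
qed simp

lemma hM_hcexp_power_eq_0:
  assumes "h \<noteq> 0" and "n < m"
  shows "hM h m (\<lambda>y. hcexp h y ^ n) s = 0"
proof -
  have "(\<Prod>j<m. (hcexp h h ^ n - hcexp h h ^ j) / complex_of_real h) = 0"
    using assms by (intro prod_zero) auto
  then show ?thesis
    by (simp only: hM_hcexp_power [OF assms(1)] mult_zero_left)
qed

lemma prod_linear_factors_expand:
  fixes b :: "nat \<Rightarrow> 'a :: comm_ring_1"
  shows "\<exists>c. \<forall>z. (\<Prod>l<n. z - b l) = (\<Sum>i<Suc n. c i * z ^ i)"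
proof -
  define P where "P = (\<Prod>l<n. [:- b l, 1:])"
  have "degree P \<le> (\<Sum>l<n. degree [:- b l, 1:])"
    unfolding P_def by (rule degree_prod_sum_le [unfolded comp_def]) simp
  also have "\<dots> \<le> n"
    using sum_bounded_above [of "{..<n}" "\<lambda>l. degree [:- b l, 1:]" 1] by simp
  finally have deg: "degree P \<le> n" .
  have "(\<Prod>l<n. z - b l) = (\<Sum>i<Suc n. coeff P i * z ^ i)" for z
  proof -
    have "(\<Prod>l<n. z - b l) = poly P z"
      by (simp add: P_def poly_prod)
    also have "\<dots> = (\<Sum>i\<le>n. coeff P i * z ^ i)"
      unfolding poly_altdef using deg
      by (intro sum.mono_neutral_left) (auto simp: coeff_eq_0)
    finally show ?thesis
      by (simp add: lessThan_Suc_atMost)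
  qed
  then show ?thesis by blast
qed

lemma hM_prod_eq_0:
  assumes "h \<noteq> 0"
  shows "hM h (Suc n) (\<lambda>y. \<Prod>l<n. hcexp h y - b l) s = 0"
proof -
  obtain c where c: "\<And>z. (\<Prod>l<n. z - b l) = (\<Sum>i<Suc n. c i * z ^ i)"
    using prod_linear_factors_expand [where n = n and b = b] by blast
  show ?thesis
    unfolding c hM_sum [OF assms] by (intro sum.neutral) (auto simp: hM_hcexp_power_eq_0 assms)
qed

lemma hM_last_value:
  assumes "h \<noteq> 0" and "\<And>i. i < m \<Longrightarrow> f (s + real i * h) = 0"
  shows "hM h m f s = f (s + real m * h) / of_real h ^ m"
  using assms(2)
proof (induction m arbitrary: s)
  case 0
  show ?case by simp
next
  case (Suc m)
  have "hM h m f s = f (s + real m * h) / of_real h ^ m"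
    using Suc.prems by (intro Suc.IH) auto
  also have "\<dots> = 0"
    using Suc.prems by simp
  finally have 1: "hM h m f s = 0" .
  have 2: "hM h m f (s + h) = f (s + h + real m * h) / of_real h ^ m"
  proof (rule Suc.IH)
    fix i assume "i < m"
    then show "f (s + h + real i * h) = 0"
      using Suc.prems [of "Suc i"] by (simp add: algebra_simps)
  qed
  show ?case
    unfolding hM_Suc_shift [OF assms(1)] 1 2 by (simp add: algebra_simps)
qed

text \<open>
  Peeling off the last factor \<open>(S - q^m) / h\<close> shows that \<open>hM h m d\<close> is a geometric progression
  with ratio \<open>q^m\<close>, as is \<open>hM h m\<close> of \<open>w^m\<close>. Hence subtracting a multiple of \<open>w^m\<close> lowers \<open>m\<close> by
  one. The multiple exists because \<open>w^m\<close> itself is not killed, that is, because \<open>q^m\<close> differs from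
  the lower powers of \<open>q\<close>.
\<close>
lemma hM_kernel:
  assumes h: "h \<noteq> 0"
    and "\<And>j. 1 \<le> j \<Longrightarrow> j < m \<Longrightarrow> hcexp h h ^ j \<noteq> 1"
    and "\<And>k. k < K \<Longrightarrow> hM h m d (a + real k * h) = 0"
  shows "\<exists>c. \<forall>k < K + m. d (a + real k * h) = (\<Sum>j<m. c j * hcexp h (a + real k * h) ^ j)"
  using assms(2,3)
proof (induction m arbitrary: d K)
  case 0
  then show ?case by simp
next
  case (Suc m)
  define q where "q = hcexp h h"
  define p where "p = (\<Prod>j<m. (q ^ m - q ^ j) / complex_of_real h)"
  have "p \<noteq> 0"
  proof -
    have "q ^ m \<noteq> q ^ j" if "j < m" for j
    proof
      assume "q ^ m = q ^ j"
      then have "q ^ j * q ^ (m - j) = q ^ j * 1"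
        using that by (simp flip: power_add)
      then have "q ^ (m - j) = 1"
        by (simp add: q_def)
      with Suc.prems(1) [of "m - j"] that show False
        by (simp add: q_def)
    qed
    then show ?thesis
      using h by (simp add: p_def)
  qed
  note killed = Suc.prems(2)
  have geo: "hM h m d (a + real k * h) = q ^ (m * k) * hM h m d a" if "k \<le> K" for k
    using that
  proof (induction k)
    case 0
    show ?case by simp
  next
    case (Suc k)
    have "hM h m d (a + real k * h + h) = q ^ m * hM h m d (a + real k * h)"
      using killed [of k] Suc.prems h by (simp add: hM_Suc_shift q_def)
    with Suc show ?case
      by (simp add: algebra_simps power_add)
  qed
  define C where "C = hM h m d a / (p * hcexp h a ^ m)"
  have "hM h m (\<lambda>y. d y - C * hcexp h y ^ m) (a + real k * h) = 0" if "k < Suc K" for k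
  proof -
    have "hcexp h (a + real k * h) ^ m = hcexp h a ^ m * q ^ (m * k)"
      by (simp only: hcexp_add hcexp_of_nat_mult q_def power_mult_distrib mult.commute [of m k]
          power_mult)
    moreover have "hM h m (\<lambda>y. d y - C * hcexp h y ^ m) (a + real k * h) =
        hM h m d (a + real k * h) - C * (p * hcexp h (a + real k * h) ^ m)"
      unfolding hM_diff [OF h] hM_cmult [OF h] hM_hcexp_power [OF h] p_def q_def ..
    ultimately show ?thesis
      using geo [of k] that \<open>p \<noteq> 0\<close> by (simp add: C_def)
  qed
  then obtain c where c: "\<And>k. k < Suc K + m \<Longrightarrow>
      d (a + real k * h) - C * hcexp h (a + real k * h) ^ m =
      (\<Sum>j<m. c j * hcexp h (a + real k * h) ^ j)"
    using Suc.IH [of "Suc K" "\<lambda>y. d y - C * hcexp h y ^ m"] Suc.prems(1) by force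
  have "d (a + real k * h) = (\<Sum>j<Suc m. (c(m := C)) j * hcexp h (a + real k * h) ^ j)"
    if "k < K + Suc m" for k
    using c [of k] that by (simp add: algebra_simps)
  then show ?case by blast
qed

section \<open>Truncated powers as fundamental solutions\<close>

text \<open>
  The truncation is stated at \<open>t = a + (k + n) h\<close>, but at the \<open>n\<close> grid points after \<open>a + k h\<close> the
  product has a vanishing factor, so the switch from zero to polynomial may be moved back to
  \<open>a + k h\<close>.
\<close>
lemma htrunc_grid:
  assumes "h > 0"
  shows "htrunc h n (a + real i * h) (a + real (k + n) * h) =
    (if i > k then \<Prod>l<n. hcexp h (a + real i * h) - hcexp h (a + real (k + n) * h - real l * h)
     else 0)"
proof -
  have iff: "a + real i * h > a + real (k + n) * h \<longleftrightarrow> i > k + n"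
    using assms by (simp del: of_nat_add)
  have "(\<Prod>l<n. hcexp h (a + real i * h) - hcexp h (a + real (k + n) * h - real l * h)) = 0"
    if "k < i" "i \<le> k + n"
  proof (rule prod_zero)
    have "real (k + n) - real (k + n - i) = real i"
      using that by simp
    then have "real (k + n) * h - real (k + n - i) * h = real i * h"
      by (metis left_diff_distrib)
    then have "a + real i * h = a + real (k + n) * h - real (k + n - i) * h"
      by simp
    moreover have "k + n - i < n"
      using that by simp
    ultimately show "\<exists>l\<in>{..<n}.
        hcexp h (a + real i * h) - hcexp h (a + real (k + n) * h - real l * h) = 0"
      by (metis lessThan_iff right_minus_eq)
  qed simp
  then show ?thesis
    unfolding htrunc_def iff by auto
qed

lemma hA_eq:
  "hA h n = (hcexp h h / of_real h) ^ n * (\<Prod>l<n. 1 - inverse (hcexp h h ^ Suc l))"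
proof -
  have "(\<Prod>j=1..n. 1 - hcexp h (- real j * h)) = (\<Prod>l<n. 1 - inverse (hcexp h h ^ Suc l))"
    by (simp add: prod.atLeast1_atMost_eq hcexp_minus hcexp_of_nat_mult del: of_nat_Suc power_Suc)
  then show ?thesis
    by (cases "n = 0") (simp_all add: hA_def)
qed

text \<open>
  Applied at \<open>a + j h\<close>, the operator sees the grid points with indices from \<open>j\<close> to \<open>j + n + 1\<close>. For
  \<open>j < k\<close> the truncated power is zero at all of them, for \<open>j > k\<close> it is a polynomial of degree \<open>n\<close>
  at all of them, and for \<open>j = k\<close> only the last value survives. That value is
  \<open>T^n q^n (1 - q^(-1)) \<dots> (1 - q^(-n))\<close>, where \<open>T\<close> is \<open>hcexp h\<close> at \<open>a + (k + n) h\<close>.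
\<close>
lemma hM_htrunc_grid:
  assumes "h > 0"
  shows "hM h (Suc n) (\<lambda>y. htrunc h n y (a + real (k + n) * h)) (a + real j * h) =
    (if j = k then hcexp h (a + real (k + n) * h) ^ n * hA h n / of_real h else 0)"
proof -
  define t where "t = a + real (k + n) * h"
  have h: "h \<noteq> 0"
    using assms by simp
  have shift: "a + real j * h + real i * h = a + real (j + i) * h" for i
    by (simp add: algebra_simps)
  note grid = htrunc_grid [OF assms, of n a _ k, folded t_def]
  consider "j < k" | "j > k" | "j = k"
    by linarith
  then have "hM h (Suc n) (\<lambda>y. htrunc h n y t) (a + real j * h) =
    (if j = k then hcexp h t ^ n * hA h n / of_real h else 0)"
  proof cases
    case 1
    have "htrunc h n (a + real (j + i) * h) t = 0" if "i \<le> Suc n" for i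
    proof -
      have "a + real (j + i) * h \<le> t"
        using 1 that assms unfolding t_def by (intro add_left_mono mult_right_mono) auto
      then show ?thesis
        by (simp add: htrunc_def)
    qed
    then have "hM h (Suc n) (\<lambda>y. htrunc h n y t) (a + real j * h) =
        hM h (Suc n) (\<lambda>y. 0 * hcexp h y) (a + real j * h)"
      by (intro hM_cong [OF h]) (simp only: shift mult_zero_left)
    also have "\<dots> = 0"
      by (subst hM_cmult [OF h]) simp
    finally show ?thesis
      using 1 by simp
  next
    case 2
    have "hM h (Suc n) (\<lambda>y. htrunc h n y t) (a + real j * h) =
        hM h (Suc n) (\<lambda>y. \<Prod>l<n. hcexp h y - hcexp h (t - real l * h)) (a + real j * h)"
      using 2 by (intro hM_cong [OF h]) (simp only: shift grid, simp)
    also have "\<dots> = 0"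
      by (rule hM_prod_eq_0 [OF h])
    finally show ?thesis
      using 2 by simp
  next
    case 3
    define T where "T = hcexp h t"
    define q where "q = hcexp h h"
    have [simp]: "T \<noteq> 0" "q \<noteq> 0"
      by (simp_all add: T_def q_def)
    have "hM h (Suc n) (\<lambda>y. htrunc h n y t) (a + real j * h) =
        htrunc h n (a + real j * h + real (Suc n) * h) t / of_real h ^ Suc n"
    proof (rule hM_last_value [OF h])
      fix i assume "i < Suc n"
      then have "a + real (j + i) * h \<le> t"
        using 3 assms unfolding t_def by (intro add_left_mono mult_right_mono) auto
      then show "htrunc h n (a + real j * h + real i * h) t = 0"
        unfolding shift by (simp add: htrunc_def)
    qed
    also have "a + real j * h + real (Suc n) * h = t + h"
      using 3 by (simp add: t_def algebra_simps)
    also have "htrunc h n (t + h) t = (\<Prod>l<n. hcexp h (t + h) - hcexp h (t - real l * h))"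
      using assms by (simp add: htrunc_def)
    also have "\<dots> = (\<Prod>l<n. (T * q) * (1 - inverse (q ^ Suc l)))"
    proof (rule prod.cong [OF refl])
      fix l
      have "hcexp h (t - real l * h) = T * inverse (q ^ l)"
        using hcexp_add [of h t "- (real l * h)"]
        by (simp add: hcexp_minus hcexp_of_nat_mult T_def q_def)
      then show "hcexp h (t + h) - hcexp h (t - real l * h) = (T * q) * (1 - inverse (q ^ Suc l))"
        by (simp add: hcexp_add field_simps flip: T_def q_def)
    qed
    also have "\<dots> = (T * q) ^ n * (\<Prod>l<n. 1 - inverse (q ^ Suc l))"
      by (simp only: prod.distrib prod_constant card_lessThan power_mult_distrib)
    also have "\<dots> / of_real h ^ Suc n = T ^ n * hA h n / of_real h"
      using h by (simp add: hA_eq power_mult_distrib power_divide mult_ac flip: q_def)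
    finally show ?thesis
      using 3 by (simp add: T_def)
  qed
  then show ?thesis
    by (simp add: t_def)
qed

section \<open>The integral representation\<close>

theorem theorem5p11:
  fixes h :: real and m :: nat and x :: "nat \<Rightarrow> real" and f :: "real \<Rightarrow> complex"
  assumes "h \<noteq> 0" and "h > -1"
    and "m \<ge> 1"
    and "strict_mono_on {0..m} x"
    and "x m - x 0 < 2 * pi * h / ln (1 + h)"
    and "\<And>j. j \<in> {1..m} \<Longrightarrow> (x j - x 0) / h \<in> \<nat>"
  shows "hdd h x f 0 m =
    1 / hA h (m - 1) *
      hintegral h (x 0) (x m)
        (\<lambda>y. hcexp h (- real (m - 1) * y) * hE0 h x m y * hM h m f (y - real (m - 1) * h))"
proof -
  have less: "x i < x j" if "i < j" "j \<le> m" for i j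
    using strict_mono_onD [OF assms(4), of i j] that by simp
  \<comment> \<open>A negative step would make the quotients \<open>(x j - x 0) / h\<close> negative.\<close>
  have h: "h > 0"
  proof -
    have "(x 1 - x 0) / h \<ge> 0"
      using assms(3) assms(6) [of 1] by (auto elim!: Nats_cases)
    moreover have "x 1 - x 0 > 0"
      using less [of 0 1] assms(3) by simp
    ultimately show ?thesis
      using assms(1) by (simp add: zero_le_divide_iff)
  qed
  then have h0: "h \<noteq> 0" and theta: "ln (1 + h) / h > 0"
    by simp_all
  have width: "(x m - x 0) * (ln (1 + h) / h) < 2 * pi"
    using assms(5) h by (simp add: field_simps)
  have distinct: "hcexp h (x j) \<noteq> hcexp h (x i)" if "i < j" "j \<le> m" for i j
  proof (rule hcexp_neq)
    show "0 < (x j - x i) * (ln (1 + h) / h)"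
      using less [OF that] theta by (intro mult_pos_pos) auto
    have "x j \<le> x m" "x 0 \<le> x i"
      using that less [of j m] less [of 0 i] by (cases "j = m"; cases "i = 0"; simp)+
    then have "(x j - x i) * (ln (1 + h) / h) \<le> (x m - x 0) * (ln (1 + h) / h)"
      using theta by (intro mult_right_mono) auto
    with width show "(x j - x i) * (ln (1 + h) / h) < 2 * pi"
      by simp
  qed

  have "\<exists>\<nu>. \<forall>j\<le>m. x j = x 0 + real (\<nu> j) * h"
  proof -
    have "\<exists>r. x j = x 0 + real r * h" if "j \<le> m" for j
    proof (cases "j = 0")
      case True
      then show ?thesis by (intro exI [of _ 0]) simp
    next
      case False
      then have "(x j - x 0) / h \<in> \<nat>"
        using assms(6) [of j] that by simp
      then obtain r where "(x j - x 0) / h = real r"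
        by (rule Nats_cases)
      then show ?thesis
        using h0 by (intro exI [of _ r]) (simp add: field_simps)
    qed
    then show ?thesis by metis
  qed
  then obtain \<nu> where \<nu>: "\<And>j. j \<le> m \<Longrightarrow> x j = x 0 + real (\<nu> j) * h"
    by blast
  have \<nu>_less: "\<nu> i < \<nu> j" if "i < j" "j \<le> m" for i j
    using less [OF that] \<nu> [of i] \<nu> [of j] that h by simp
  define N where "N = \<nu> m"
  have \<nu>_ge: "j \<le> \<nu> j" if "j \<le> m" for j
    using that
  proof (induction j)
    case (Suc j)
    then show ?case using \<nu>_less [of j "Suc j"] by simp
  qed simp
  have \<nu>_le: "\<nu> j \<le> N" if "j \<le> m" for j
    using \<nu>_less [of j m] that unfolding N_def by (cases "j = m") auto

  have powers: "hcexp h h ^ j \<noteq> 1" if "1 \<le> j" "j \<le> m" for j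
  proof -
    have "hcexp h (real j * h) \<noteq> 1"
    proof (rule hcexp_neq_1)
      show "0 < real j * h * (ln (1 + h) / h)"
        using that h theta by (intro mult_pos_pos) auto
      have "real j * h \<le> x m - x 0"
        using \<nu> [of m] \<nu>_ge [of m] that h by simp
      then have "real j * h * (ln (1 + h) / h) \<le> (x m - x 0) * (ln (1 + h) / h)"
        using theta by (intro mult_right_mono) auto
      with width show "real j * h * (ln (1 + h) / h) < 2 * pi"
        by simp
    qed
    then show ?thesis
      by (simp add: hcexp_of_nat_mult)
  qed

  define n where "n = m - 1"
  have m: "m = Suc n"
    using assms(3) by (simp add: n_def)
  have A: "hA h n \<noteq> 0"
  proof -
    have "inverse (hcexp h h ^ Suc l) \<noteq> 1" if "l < n" for l
      using powers [of "Suc l"] that by (simp add: m del: power_Suc)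
    then show ?thesis
      using h0 by (auto simp: hA_eq simp del: power_Suc)
  qed

  \<comment> \<open>The grid starts \<open>n\<close> steps before \<open>x 0\<close>: the argument of \<open>hM h m f\<close> in the integrand is then
    \<open>a + k h\<close> when \<open>y\<close> is the \<open>k\<close>-th summation point.\<close>
  define a where "a = x 0 - real n * h"
  define t where "t k = a + real (k + n) * h" for k
  define c where "c k = of_real h / hA h n * hcexp h (- real n * t k) * hM h m f (a + real k * h)"
    for k
  define g where "g y = (\<Sum>k<N. c k * htrunc h n y (t k))" for y
  have "hM h m g (a + real j * h) = hM h m f (a + real j * h)" if "j < N" for j
  proof -
    have inv: "hcexp h (- real n * t j) = inverse (hcexp h (t j) ^ n)"
      by (simp only: mult_minus_left hcexp_minus hcexp_of_nat_mult)
    have "hM h m g (a + real j * h) =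
        (\<Sum>k<N. c k * (if j = k then hcexp h (t k) ^ n * hA h n / of_real h else 0))"
      unfolding g_def hM_sum [OF h0] m t_def hM_htrunc_grid [OF h] ..
    also have "\<dots> = c j * (hcexp h (t j) ^ n * hA h n / of_real h)"
      using that by (simp add: if_distrib sum.delta cong: if_cong)
    also have "\<dots> = hM h m f (a + real j * h)"
      unfolding c_def inv using A h0 by simp
    finally show ?thesis .
  qed
  then have "hM h m (\<lambda>y. f y - g y) (a + real k * h) = 0" if "k < N" for k
    using that by (simp add: hM_diff [OF h0])
  with powers obtain b where b: "\<And>k. k < N + m \<Longrightarrow>
      f (a + real k * h) - g (a + real k * h) = (\<Sum>j<m. b j * hcexp h (a + real k * h) ^ j)"
    using hM_kernel [OF h0, of m N "\<lambda>y. f y - g y" a] by fastforce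
  have "f (x j) - g (x j) = (\<Sum>i<m. b i * hcexp h (x j) ^ i)" if "j \<le> m" for j
  proof -
    have "x j = a + real (\<nu> j + n) * h"
      using \<nu> [OF that] by (simp add: a_def algebra_simps)
    with b [of "\<nu> j + n"] \<nu>_le [OF that] show ?thesis
      by (simp add: m)
  qed
  then have "hdd h x (\<lambda>y. f y - g y) 0 m = hdd h x (\<lambda>y. \<Sum>i<m. b i * hcexp h y ^ i) 0 m"
    by (intro hdd_cong) simp
  also have "\<dots> = (\<Sum>i<m. b i * hdd h x (\<lambda>y. hcexp h y ^ i) 0 m)"
    by (rule hdd_sum)
  also have "\<dots> = 0"
    using distinct by (intro sum.neutral ballI) (simp add: hdd_hcexp_power_eq_0)
  finally have "hdd h x f 0 m = hdd h x g 0 m"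
    by (simp add: hdd_diff)
  also have "\<dots> = (\<Sum>k<N. c k * hE0 h x m (t k))"
    unfolding g_def hdd_sum by (simp add: hE0_def n_def)
  finally have dd: "hdd h x f 0 m = (\<Sum>k<N. c k * hE0 h x m (t k))" .

  have floor: "nat \<lfloor>(x m - x 0) / h\<rfloor> = N"
    using \<nu> [of m] h0 by (simp add: N_def)
  have t: "x 0 + real k * h = t k" "t k - real n * h = a + real k * h" for k
    by (simp_all add: t_def a_def algebra_simps)
  have "x 0 < x m"
    using less [of 0 m] assms(3) by simp
  then show ?thesis
    unfolding hintegral_def floor t dd n_def [symmetric]
    by (simp add: t c_def sum_distrib_left algebra_simps)
qed

end
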